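(* Let $\mathcal{H}$ be a complex separable Hilbert space and let $\mathcal{M},\mathcal{N}$ be (not necessarily closed) subspaces of $\mathcal{H}$. If $P_{\mathcal{M},\mathcal{N}}$ admits a $2\times 2$ block matrix representation with respect to $\overline{\mathcal{M}}$, then $$P_{\mathcal{M},\mathcal{N}}=\begin{pmatrix} P_{\mathcal{M},\,\overline{\mathcal{M}}\cap\mathcal{N}} & x\\ 0&0\end{pmatrix}_{\overline{\mathcal{M}}},$$ where $x:=P_{\mathcal{M},\mathcal{N}}\cap(\mathcal{M}^\perp\times\mathcal{H})$, regarded as a linear relation from $\mathcal{M}^\perp$ to $\overline{\mathcal{M}}$ (it equals $P_{\overline{\mathcal{M}}}\,P_{\mathcal{M},\mathcal{N}}|_{\mathcal{M}^\perp}$).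
   Context: A linear relation from $\mathcal{H}$ to $\mathcal{K}$ is a linear subspace of $\mathcal{H}\times\mathcal{K}$; operators are identified with their graphs. For subspaces $\mathcal{M},\mathcal{N}$ of $\mathcal{H}$, $P_{\mathcal{M},\mathcal{N}}:=\{(m+n,m): m\in\mathcal{M},\ n\in\mathcal{N}\}$ is the multivalued projection with range $\mathcal{M}$ and kernel $\mathcal{N}$. The block $P_{\mathcal{M},\overline{\mathcal{M}}\cap\mathcal{N}}$ is regarded as a linear relation in $\overline{\mathcal{M}}\times\overline{\mathcal{M}}$. Block matrices: for a closed subspace $\mathcal{S}$ of $\mathcal{H}$ and linear relations $a$ from $\mathcal{S}$ to $\mathcal{S}$, $b$ from $\mathcal{S}^\perp$ to $\mathcal{S}$, $c$ from $\mathcal{S}$ to $\mathcal{S}^\perp$, $d$ from $\mathcal{S}^\perp$ to $\mathcal{S}^\perp$, $$\begin{pmatrix} a&b\\c&d\end{pmatrix}_{\mathcal{S}}:=\{(x_1+x_2,(w_1+z_1)+(w_2+z_2)):(x_1,w_1)\in a,\ (x_2,z_1)\in b,\ (x_1,w_2)\in c,\ (x_2,z_2)\in d\}.$$ A linear relation $T\subseteq\mathcal{H}\times\mathcal{H}$ admits a $2\times2$ block matrix representation with respect to $\mathcal{S}$ if there exist linear relations $a$ from $\mathcal{S}$ to $\mathcal{S}$, $b$ from $\mathcal{S}^\perp$ to $\mathcal{S}$, $c$ from $\mathcal{S}$ to $\mathcal{S}^\perp$ and $d$ from $\mathcal{S}^\perp$ to $\mathcal{S}^\perp$ with $T=\begin{pmatrix}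 a&b\\c&d\end{pmatrix}_{\mathcal{S}}$. Entries $0$ denote the everywhere defined zero operators between the corresponding subspaces. Equality is equality of linear relations. *)

theory Defs
  imports "HOL-Analysis.Analysis"
begin

section \<open>Complex Hilbert spaces\<close>

class complex_vector = real_vector +
  fixes scaleC :: "complex \<Rightarrow> 'a \<Rightarrow> 'a"  (infixr \<open>*\<^sub>C\<close> 75)
  assumes scaleC_add_right: "a *\<^sub>C (x + y) = a *\<^sub>C x + a *\<^sub>C y"
    and scaleC_add_left: "(a + b) *\<^sub>C x = a *\<^sub>C x + b *\<^sub>C x"
    and scaleC_scaleC: "a *\<^sub>C b *\<^sub>C x = (a * b) *\<^sub>C x"
    and scaleC_one: "1 *\<^sub>C x = x"
    and scaleR_scaleC: "r *\<^sub>R x = complex_of_real r *\<^sub>C x"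

global_interpretation complex_vector:
  vector_space "scaleC :: complex \<Rightarrow> 'a \<Rightarrow> 'a::complex_vector"
  by unfold_locales (simp_all add: scaleC_add_right scaleC_add_left scaleC_scaleC scaleC_one)

instantiation prod :: (complex_vector, complex_vector) complex_vector
begin

definition scaleC_prod :: "complex \<Rightarrow> 'a \<times> 'b \<Rightarrow> 'a \<times> 'b"
  where "scaleC_prod c p = (c *\<^sub>C fst p, c *\<^sub>C snd p)"

instance
  by standard
    (simp_all add: scaleC_prod_def scaleC_add_right scaleC_add_left scaleC_scaleC scaleC_one
      prod_eq_iff scaleR_scaleC)

end

text \<open>The inner product is linear in its first argument. Positivity and definiteness are implied
  by the axioms on the norm, but are listed to match the usual definition. The topology is the
  norm topology inherited from \<^class>\<open>real_normed_vector\<close>.\<close>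

class complex_inner = complex_vector + real_normed_vector +
  fixes cinner :: "'a \<Rightarrow> 'a \<Rightarrow> complex"
  assumes cinner_commute: "cinner x y = cnj (cinner y x)"
    and cinner_add_left: "cinner (x + y) z = cinner x z + cinner y z"
    and cinner_scaleC_left: "cinner (c *\<^sub>C x) y = c * cinner x y"
    and cinner_ge_zero: "0 \<le> Re (cinner x x)"
    and cinner_eq_zero_iff: "cinner x x = 0 \<longleftrightarrow> x = 0"
    and norm_eq_sqrt_cinner: "norm x = sqrt (Re (cinner x x))"

class chilbert_space = complex_inner + complete_space

instantiation complex :: chilbert_space
begin

definition scaleC_complex :: "complex \<Rightarrow> complex \<Rightarrow> complex"
  where "scaleC_complex c x = c * x"

definition cinner_complex :: "complex \<Rightarrow> complex \<Rightarrow> complex"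
  where "cinner_complex x y = x * cnj y"

instance
  by standard
    (simp_all add: scaleC_complex_def cinner_complex_def algebra_simps scaleR_conv_of_real
      cmod_def power2_eq_square)

end

definition orthogonal_complement :: "'a::complex_inner set \<Rightarrow> 'a set"
  where "orthogonal_complement S = {x. \<forall>y\<in>S. cinner x y = 0}"

section \<open>Linear relations\<close>

definition linear_relation ::
    "'a::complex_vector set \<Rightarrow> 'b::complex_vector set \<Rightarrow> ('a \<times> 'b) set \<Rightarrow> bool"
  where "linear_relation S T r \<longleftrightarrow> complex_vector.subspace r \<and> r \<subseteq> S \<times> T"

definition zero_relation :: "'a set \<Rightarrow> ('a \<times> 'b::zero) set"
  where "zero_relation S = S \<times> {0}"

definition restrict_relation :: "('a \<times> 'b) set \<Rightarrow> 'a set \<Rightarrow> ('a \<times> 'b) set"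
  where "restrict_relation r S = r \<inter> (S \<times> UNIV)"

definition mv_projection :: "'a::plus set \<Rightarrow> 'a set \<Rightarrow> ('a \<times> 'a) set"
  where "mv_projection M N = {(m + n, m) | m n. m \<in> M \<and> n \<in> N}"

text \<open>The graph of the orthogonal projection onto \<open>S\<close>, for a closed subspace \<open>S\<close>.\<close>

definition orthogonal_projection :: "'a::complex_inner set \<Rightarrow> ('a \<times> 'a) set"
  where "orthogonal_projection S = mv_projection S (orthogonal_complement S)"

section \<open>Block matrix representations\<close>

text \<open>The decomposing subspace \<open>S\<close> enters only through the requirement, made explicit in
  \<open>block_entries\<close>, on where the four entries live.\<close>

definition block_matrix ::
    "('a::plus \<times> 'a) set \<Rightarrow> ('a \<times> 'a) set \<Rightarrow> ('a \<times> 'a) set \<Rightarrow> ('a \<times> 'a) set \<Rightarrow> ('a \<times> 'a) set"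
  where "block_matrix a b c d =
    {(x1 + x2, (w1 + z1) + (w2 + z2)) | x1 x2 w1 z1 w2 z2.
      (x1, w1) \<in> a \<and> (x2, z1) \<in> b \<and> (x1, w2) \<in> c \<and> (x2, z2) \<in> d}"

definition block_entries ::
    "'a::complex_inner set \<Rightarrow> ('a \<times> 'a) set \<Rightarrow> ('a \<times> 'a) set \<Rightarrow> ('a \<times> 'a) set \<Rightarrow> ('a \<times> 'a) set \<Rightarrow> bool"
  where "block_entries S a b c d \<longleftrightarrow>
    linear_relation S S a \<and> linear_relation (orthogonal_complement S) S b \<and>
    linear_relation S (orthogonal_complement S) c \<and> linear_relation (orthogonal_complement S) (orthogonal_complement S) d"

definition admits_block_matrix :: "'a::complex_inner set \<Rightarrow> ('a \<times> 'a) set \<Rightarrow> bool"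
  where "admits_block_matrix S T \<longleftrightarrow>
    (\<exists>a b c d. block_entries S a b c d \<and> T = block_matrix a b c d)"

end

theory Submission imports Defs begin

text \<open>Write \<open>S\<close> for the closure of \<open>M\<close>. The range of \<open>P\<^bsub>M,N\<^esub>\<close> lies in \<open>S\<close>, so taking one of the
  two arguments of a given representation to be 0 shows that the entries \<open>c\<close> and \<open>d\<close> vanish where
  they matter. Hence every element of \<open>P\<^bsub>M,N\<^esub>\<close> splits as a sum of elements of \<open>P\<^bsub>M,N\<^esub>\<close> with first
  components in \<open>S\<close> and in its orthogonal complement.\<close>

section \<open>Complex scalars, norms and closures of subspaces\<close>

lemma cinner_add_right: "cinner x (y + z) = cinner x y + cinner x (z::'a::complex_inner)"
  by (metis cinner_add_left cinner_commute complex_cnj_add)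

lemma cinner_scaleC_right: "cinner x (c *\<^sub>C y) = cnj c * cinner x (y::'a::complex_inner)"
  by (metis cinner_commute cinner_scaleC_left complex_cnj_mult)

lemma cinner_zero_left [simp]: "cinner 0 (x::'a::complex_inner) = 0"
  using cinner_add_left [of 0 0 x] by simp

lemma cinner_minus_left: "cinner (- x) y = - cinner x (y::'a::complex_inner)"
  using cinner_add_left [of x "- x" y] by (simp add: eq_neg_iff_add_eq_0 add.commute)

lemma cinner_minus_right: "cinner x (- y) = - cinner x (y::'a::complex_inner)"
  by (metis cinner_commute cinner_minus_left complex_cnj_minus)

lemma norm_scaleC: "norm (c *\<^sub>C x) = cmod c * norm (x::'a::complex_inner)"
proof -
  have "cinner (c *\<^sub>C x) (c *\<^sub>C x) = c * cnj c * cinner x x"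
    by (simp add: cinner_scaleC_left cinner_scaleC_right)
  also have "c * cnj c = of_real ((cmod c)\<^sup>2)"
    by (simp only: complex_norm_square)
  finally have "Re (cinner (c *\<^sub>C x) (c *\<^sub>C x)) = (cmod c)\<^sup>2 * Re (cinner x x)"
    by (simp del: of_real_power)
  then show ?thesis
    by (simp add: norm_eq_sqrt_cinner [where 'a = 'a] real_sqrt_mult)
qed

text \<open>Continuity of scaling by a complex number is what carries limits through
  \<open>scaleC\<close>, both for closures of subspaces and for orthogonality.\<close>

lemma bounded_linear_scaleC: "bounded_linear (\<lambda>x::'a::complex_inner. c *\<^sub>C x)"
  by (rule bounded_linear_intro [where K = "cmod c"])
    (simp_all add: scaleC_add_right scaleR_scaleC scaleC_scaleC norm_scaleC ac_simps)

lemma subspace_closure_complex: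
  fixes M :: "'a::complex_inner set"
  assumes "complex_vector.subspace M"
  shows "complex_vector.subspace (closure M)"
proof (rule complex_vector.subspaceI)
  show "0 \<in> closure M"
    using assms closure_subset complex_vector.subspace_0 by blast
next
  fix x y assume "x \<in> closure M" "y \<in> closure M"
  then obtain f g where "\<forall>n. f n \<in> M" "f \<longlonglongrightarrow> x" "\<forall>n. g n \<in> M" "g \<longlonglongrightarrow> y"
    by (auto simp: closure_sequential)
  then show "x + y \<in> closure M"
    unfolding closure_sequential
    by (intro exI [of _ "\<lambda>n. f n + g n"])
      (auto intro: tendsto_add complex_vector.subspace_add [OF assms])
next
  fix c x assume "x \<in> closure M"
  then obtain f where "\<forall>n. f n \<in> M" "f \<longlonglongrightarrow> x"
    by (auto simp: closure_sequential)
  then show "c *\<^sub>C x \<in> closure M"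
    unfolding closure_sequential
    by (intro exI [of _ "\<lambda>n. c *\<^sub>C f n"])
      (auto intro: bounded_linear.tendsto [OF bounded_linear_scaleC]
        complex_vector.subspace_scale [OF assms])
qed

section \<open>Orthogonality and its stability under closure\<close>

text \<open>The two squared norms differ by \<open>4 * Re (cinner x y)\<close>. With
  \<open>\<i> *\<^sub>C y\<close> in place of \<open>y\<close> the same criterion detects the
  imaginary part, since \<open>Re (cinner x (\<i> *\<^sub>C y)) = Im (cinner x y)\<close>.\<close>

lemma Re_cinner_eq_0_iff:
  "Re (cinner x y) = 0 \<longleftrightarrow> norm (x + y) = norm (x - (y::'a::complex_inner))"
proof -
  have "Re (cinner y x) = Re (cinner x y)"
    by (subst cinner_commute) simp
  then have "Re (cinner (x + y) (x + y)) = Re (cinner x x) + 2 * Re (cinner x y) + Re (cinner y y)"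
    and "Re (cinner (x + - y) (x + - y)) = Re (cinner x x) - 2 * Re (cinner x y) + Re (cinner y y)"
    by (simp_all only: cinner_add_left cinner_add_right cinner_minus_left cinner_minus_right
        plus_complex.sel uminus_complex.sel)
  then show ?thesis
    by (auto simp: norm_eq_sqrt_cinner)
qed

text \<open>Polarization describes orthogonality by equalities of norms, so that its stability under
  limits needs no Cauchy-Schwarz inequality.\<close>

lemma cinner_eq_0_iff_norm:
  fixes x y :: "'a::complex_inner"
  shows "cinner x y = 0 \<longleftrightarrow>
    norm (x + y) = norm (x - y) \<and> norm (x + \<i> *\<^sub>C y) = norm (x - \<i> *\<^sub>C y)"
  by (simp add: complex_eq_iff cinner_scaleC_right flip: Re_cinner_eq_0_iff)

lemma closed_cinner_eq_0: "closed {y. cinner x y = (0::complex)}" for x :: "'a::complex_inner"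
  unfolding cinner_eq_0_iff_norm
  by (intro closed_Collect_conj closed_Collect_eq continuous_intros
      bounded_linear.continuous_on [OF bounded_linear_scaleC])

text \<open>For fixed \<open>x\<close>, the vectors orthogonal to \<open>x\<close> form a closed
  set, which contains \<open>closure M\<close> as soon as it contains \<open>M\<close>. This
  reconciles the domain of the entry \<open>x\<close> in the theorem with the complement used in
  \<open>block_entries\<close>.\<close>

lemma orthogonal_complement_closure: "orthogonal_complement (closure M) = orthogonal_complement M"
proof
  show "orthogonal_complement (closure M) \<subseteq> orthogonal_complement M"
    using closure_subset by (auto simp: orthogonal_complement_def)
  show "orthogonal_complement M \<subseteq> orthogonal_complement (closure M)"
  proof
    fix x assume "x \<in> orthogonal_complement M"
    then have "M \<subseteq> {y. cinner x y = 0}"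
      by (auto simp: orthogonal_complement_def)
    then have "closure M \<subseteq> {y. cinner x y = 0}"
      using closed_cinner_eq_0 by (rule closure_minimal)
    then show "x \<in> orthogonal_complement (closure M)"
      by (auto simp: orthogonal_complement_def)
  qed
qed

lemma subspace_orthogonal_complement: "complex_vector.subspace (orthogonal_complement S)"
  by (rule complex_vector.subspaceI)
    (auto simp: orthogonal_complement_def cinner_add_left cinner_scaleC_left)

lemma orthogonal_complement_disjoint:
  "x \<in> S \<Longrightarrow> x \<in> orthogonal_complement S \<Longrightarrow> x = 0"
  by (auto simp: orthogonal_complement_def cinner_eq_zero_iff)

section \<open>Linear relations, multivalued projections and block matrices\<close>

lemma subspace_Times:
  assumes "complex_vector.subspace S" "complex_vector.subspace T"
  shows "complex_vector.subspace (S \<times> T)"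
  using assms
  by (auto simp: complex_vector.subspace_def scaleC_prod_def zero_prod_def)

lemma linear_relation_zero_relation:
  assumes "complex_vector.subspace S" "complex_vector.subspace T"
  shows "linear_relation S T (zero_relation S)"
  using subspace_Times [OF assms(1) complex_vector.subspace_single_0]
    complex_vector.subspace_0 [OF assms(2)]
  by (auto simp: linear_relation_def zero_relation_def)

lemma subspace_mv_projection:
  assumes M: "complex_vector.subspace M" and N: "complex_vector.subspace N"
  shows "complex_vector.subspace (mv_projection M N)"
proof (rule complex_vector.subspaceI)
  show "0 \<in> mv_projection M N"
    using complex_vector.subspace_0 [OF M] complex_vector.subspace_0 [OF N]
    by (force simp: mv_projection_def zero_prod_def)
next
  fix p q assume "p \<in> mv_projection M N" "q \<in> mv_projection M N"
  then obtain m n m' n' where "p = (m + n, m)" "q = (m' + n', m')"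
    and "m \<in> M" "n \<in> N" "m' \<in> M" "n' \<in> N"
    by (auto simp: mv_projection_def)
  then show "p + q \<in> mv_projection M N"
    unfolding mv_projection_def
    by (intro CollectI exI [of _ "m + m'"] exI [of _ "n + n'"])
      (auto simp: algebra_simps complex_vector.subspace_add M N)
next
  fix c p assume "p \<in> mv_projection M N"
  then obtain m n where "p = (m + n, m)" "m \<in> M" "n \<in> N"
    by (auto simp: mv_projection_def)
  then show "c *\<^sub>C p \<in> mv_projection M N"
    unfolding mv_projection_def
    by (intro CollectI exI [of _ "c *\<^sub>C m"] exI [of _ "c *\<^sub>C n"])
      (auto simp: scaleC_prod_def scaleC_add_right complex_vector.subspace_scale M N)
qed

text \<open>If \<open>m\<close> and \<open>m + n\<close> lie in \<open>S\<close>, so does their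
  difference \<open>n\<close>. The upper left block thus becomes a restriction of the projection,
  which makes it a subspace and a part of the whole relation.\<close>

lemma mv_projection_Int_superspace:
  assumes "complex_vector.subspace S" "M \<subseteq> S"
  shows "mv_projection M (S \<inter> N) = mv_projection M N \<inter> (S \<times> S)"
proof
  show "mv_projection M (S \<inter> N) \<subseteq> mv_projection M N \<inter> (S \<times> S)"
    using assms by (auto simp: mv_projection_def complex_vector.subspace_add)
  show "mv_projection M N \<inter> (S \<times> S) \<subseteq> mv_projection M (S \<inter> N)"
  proof
    fix p assume "p \<in> mv_projection M N \<inter> (S \<times> S)"
    then obtain m n where p: "p = (m + n, m)" "m \<in> M" "n \<in> N" "m + n \<in> S" "m \<in> S"
      by (auto simp: mv_projection_def)
    then have "n \<in> S"
      using complex_vector.subspace_diff [OF assms(1) p(4,5)] by simp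
    with p show "p \<in> mv_projection M (S \<inter> N)"
      by (auto simp: mv_projection_def)
  qed
qed

text \<open>In a decomposition \<open>v = w + n\<close> of a vector of \<open>S\<close>, the summand
  \<open>n\<close> lies both in \<open>S\<close> and in its orthogonal complement, hence
  vanishes.\<close>

lemma orthogonal_projection_fixes:
  assumes S: "complex_vector.subspace S" and "v \<in> S"
  shows "(v, w) \<in> orthogonal_projection S \<longleftrightarrow> w = v"
proof
  assume "(v, w) \<in> orthogonal_projection S"
  then obtain n where "v = w + n" "w \<in> S" "n \<in> orthogonal_complement S"
    by (auto simp: orthogonal_projection_def mv_projection_def)
  moreover from this have "n \<in> S"
    using complex_vector.subspace_diff [OF S \<open>v \<in> S\<close> \<open>w \<in> S\<close>] by simp
  ultimately show "w = v"
    using orthogonal_complement_disjoint by force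
next
  assume "w = v"
  then show "(v, w) \<in> orthogonal_projection S"
    using complex_vector.subspace_0 [OF subspace_orthogonal_complement] \<open>v \<in> S\<close>
    by (force simp: orthogonal_projection_def mv_projection_def)
qed

text \<open>The conclusion mentions only \<open>T\<close> and no longer the given entries, so new
  entries can be read off as restrictions of \<open>T\<close>.\<close>

lemma block_matrix_splits_if_range_subset:
  fixes S :: "'a::complex_inner set"
  assumes S: "complex_vector.subspace S"
    and entries: "block_entries S a b c d"
    and T: "T = block_matrix a b c d"
    and range: "T \<subseteq> UNIV \<times> S"
    and "p \<in> T"
  obtains x1 x2 w z where "p = (x1 + x2, w + z)" "(x1, w) \<in> T" "(x2, z) \<in> T"
    "x1 \<in> S" "x2 \<in> orthogonal_complement S"
proof -
  let ?S' = "orthogonal_complement S"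
  have lin: "linear_relation S S a" "linear_relation ?S' S b"
      "linear_relation S ?S' c" "linear_relation ?S' ?S' d"
    using entries by (simp_all add: block_entries_def)
  then have zero: "(0, 0) \<in> a" "(0, 0) \<in> b" "(0, 0) \<in> c" "(0, 0) \<in> d"
    unfolding linear_relation_def zero_prod_def [symmetric]
    by (auto dest: complex_vector.subspace_0)
  obtain x1 x2 w1 z1 w2 z2 where p: "p = (x1 + x2, (w1 + z1) + (w2 + z2))"
    and e: "(x1, w1) \<in> a" "(x2, z1) \<in> b" "(x1, w2) \<in> c" "(x2, z2) \<in> d"
    using \<open>p \<in> T\<close> T by (auto simp: block_matrix_def)
  have mem: "x1 \<in> S" "x2 \<in> ?S'" "w1 \<in> S" "z1 \<in> S" "w2 \<in> ?S'" "z2 \<in> ?S'"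
    using lin e by (auto simp: linear_relation_def)
  \<comment> \<open>The zero pairs of \<open>b\<close> and \<open>d\<close> fill the second column,
    so the first column alone yields an element of \<open>T\<close>.\<close>
  have "(x1 + 0, (w1 + 0) + (w2 + 0)) \<in> T"
    unfolding T block_matrix_def using e zero by blast
  then have T1: "(x1, w1 + w2) \<in> T" by simp
  \<comment> \<open>Since \<open>T\<close> has its range in \<open>S\<close>, the vector
    \<open>w2\<close> is a difference of vectors of \<open>S\<close>, yet it also lies in the
    orthogonal complement.\<close>
  then have "(w1 + w2) - w1 \<in> S"
    using range mem by (blast intro: complex_vector.subspace_diff [OF S])
  then have w2: "w2 = 0"
    using mem orthogonal_complement_disjoint by auto
  have "(0 + x2, (0 + z1) + (0 + z2)) \<in> T"
    unfolding T block_matrix_def using e zero by blast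
  then have T2: "(x2, z1 + z2) \<in> T" by simp
  then have "(z1 + z2) - z1 \<in> S"
    using range mem by (blast intro: complex_vector.subspace_diff [OF S])
  then have z2: "z2 = 0"
    using mem orthogonal_complement_disjoint by auto
  show thesis
    using that [of x1 x2 w1 z1] p T1 T2 mem w2 z2 by simp
qed

theorem theorem3p7:
  fixes M N :: "'a::chilbert_space set"
  assumes separable: "separable_space (euclidean :: 'a topology)"
    and M: "complex_vector.subspace M"
    and N: "complex_vector.subspace N"
    and admits: "admits_block_matrix (closure M) (mv_projection M N)"
  shows "let x = mv_projection M N \<inter> (orthogonal_complement M \<times> UNIV);
             a = mv_projection M (closure M \<inter> N);
             c = zero_relation (closure M);
             d = zero_relation (orthogonal_complement (closure M))
         in block_entries (closure M) a x c d
          \<and> mv_projection M N = block_matrix a x c d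
          \<and> x = restrict_relation (mv_projection M N) (orthogonal_complement M) O orthogonal_projection (closure M)"
proof -
  define S where "S = closure M"
  let ?P = "mv_projection M N" and ?S' = "orthogonal_complement S"
  let ?x = "?P \<inter> (?S' \<times> UNIV)" and ?a = "mv_projection M (S \<inter> N)"
  have perp: "orthogonal_complement M = ?S'"
    by (simp add: S_def orthogonal_complement_closure)
  have S: "complex_vector.subspace S"
    unfolding S_def using M by (rule subspace_closure_complex)
  have S': "complex_vector.subspace ?S'"
    by (rule subspace_orthogonal_complement)
  have "M \<subseteq> S"
    unfolding S_def by (rule closure_subset)
  then have range: "?P \<subseteq> UNIV \<times> S"
    by (auto simp: mv_projection_def)
  have P: "complex_vector.subspace ?P"
    using M N by (rule subspace_mv_projection)
  have a: "?a = ?P \<inter> (S \<times> S)"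
    using S \<open>M \<subseteq> S\<close> by (rule mv_projection_Int_superspace)
  \<comment> \<open>Written this way, the entry is an intersection of two subspaces and visibly
    takes its values in \<open>S\<close>.\<close>
  have x: "?x = ?P \<inter> (?S' \<times> S)"
    using range by auto
  have "linear_relation S S ?a"
    unfolding linear_relation_def a
    using complex_vector.subspace_inter [OF P subspace_Times [OF S S]] by auto
  moreover have "linear_relation ?S' S ?x"
    unfolding linear_relation_def x
    using complex_vector.subspace_inter [OF P subspace_Times [OF S' S]] by auto
  ultimately have entries: "block_entries S ?a ?x (zero_relation S) (zero_relation ?S')"
    using S S' by (simp add: block_entries_def linear_relation_zero_relation)
  obtain a' b' c' d' where rep: "block_entries S a' b' c' d'" "?P = block_matrix a' b' c' d'"
    using admits by (auto simp: admits_block_matrix_def S_def)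
  have block: "?P = block_matrix ?a ?x (zero_relation S) (zero_relation ?S')"
  proof
    show "?P \<subseteq> block_matrix ?a ?x (zero_relation S) (zero_relation ?S')"
    proof
      fix p assume "p \<in> ?P"
      with S rep range obtain x1 x2 w z where *: "p = (x1 + x2, w + z)" "(x1, w) \<in> ?P" "(x2, z) \<in> ?P"
        "x1 \<in> S" "x2 \<in> ?S'"
        by (rule block_matrix_splits_if_range_subset)
      then have "(x1, w) \<in> ?a" "(x2, z) \<in> ?x"
        using a range by auto
      \<comment> \<open>Both lower entries are zero relations, so the witnesses for their values are
        0.\<close>
      with * show "p \<in> block_matrix ?a ?x (zero_relation S) (zero_relation ?S')"
        unfolding block_matrix_def zero_relation_def mem_Collect_eq
        by (intro exI [of _ x1] exI [of _ x2] exI [of _ w] exI [of _ z] exI [of _ 0]) simp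
    qed
    \<comment> \<open>Both upper entries are contained in \<open>?P\<close>, which is closed under
      addition, and the lower entries add nothing.\<close>
    show "block_matrix ?a ?x (zero_relation S) (zero_relation ?S') \<subseteq> ?P"
      unfolding a
      by (auto simp: block_matrix_def zero_relation_def dest: complex_vector.subspace_add [OF P])
  qed
  \<comment> \<open>All values of \<open>?P\<close> already lie in \<open>S\<close>, where the
    orthogonal projection acts as the identity.\<close>
  have proj: "?x = restrict_relation ?P ?S' O orthogonal_projection S"
  proof (intro set_eqI iffI)
    fix p assume "p \<in> ?x"
    then obtain u v where "p = (u, v)" "(u, v) \<in> restrict_relation ?P ?S'" "v \<in> S"
      using range by (auto simp: restrict_relation_def)
    then show "p \<in> restrict_relation ?P ?S' O orthogonal_projection S"
      using orthogonal_projection_fixes [OF S] by blast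
  next
    fix p assume "p \<in> restrict_relation ?P ?S' O orthogonal_projection S"
    then obtain u v w where "p = (u, w)" "(u, v) \<in> ?P" "u \<in> ?S'"
      and "(v, w) \<in> orthogonal_projection S"
      by (auto simp: restrict_relation_def)
    moreover from this have "w = v"
      using range orthogonal_projection_fixes [OF S] by blast
    ultimately show "p \<in> ?x"
      by simp
  qed
  show ?thesis
    using entries block proj by (simp add: Let_def perp S_def [symmetric])
qed

end
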